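(* Every graph $G$ (finite or infinite) has an orientation $\vec G$ containing no directed $\omega$-paths of infinite diameter in $G$. This implies that $G\not\Rightarrow\vec I_\omega$ and $G\not\Rightarrow\vec I_{-\omega}$.
   Context: Graphs are simple and undirected. A digraph has neither loops nor pairs of opposite arcs. An orientation $\vec G$ of a graph $G$ is a digraph on $V_G$ obtained by replacing each edge $\{a,b\}$ by exactly one of $(a,b)$, $(b,a)$. The distance $d_G(u,v)$ is the smallest number of edges of a path in $G$ joining $u$ and $v$ ($\infty$ if there is none); distance in a digraph is the distance in its underlying undirected graph. The diameter in $G$ of a set $A\subset V_G$ is $\sup\{d_G(u,v):u,v\in A\}\in\omega\cup\{\infty\}$, where $\omega=\{0,1,2,\dots\}$. An $\omega$-path in $G$ is a sequence $(v_n)_{n\in\omega}$ of distinct vertices such that $\{v_n,v_{n+1}\}$ is an edge of $G$ for every $n\in\omega$; its diameter is that of the set $\{v_n:n\in\omega\}$. It is directed in an orientation $\vec G$ if either $(v_n,v_{n+1})\in E_{\vec G}$ for all $n\in\omega$, or $(v_{n+1},v_n)\in E_{\vec G}$ for all $n\in\omega$. $\vec I_\omega$ and $\vec I_{-\omega}$ are the digraphs with vertex set $\omega$ and edge sets $\{(i,i+1):i\in\omega\}$ and $\{(i+1,i):i\in\omega\}$ respectively. For a graph $G$ and a digraph $\vec H$, $G\Rightarrow\vec H$ means: for every orientation $\vec G$ of $G$ there is an injective map $f:V_{\vec H}\to V_G$ such that (i) for all $u,v\in V_{\vec H}$, $(u,v)\in E_{\vec H}$ if and only if $(f(u),f(v))\in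 E_{\vec G}$, and (ii) $d_{\vec H}(u,v)=d_G(f(u),f(v))$ for all $u,v\in V_{\vec H}$. *)

theory Defs
  imports
    "Graph_Theory.Digraph_Component"
    "Graph_Theory.Vertex_Walk"
    "HOL-Library.Extended_Nat"
begin

text \<open>
  Following the library, a simple undirected graph is a symmetric loop-free digraph
  (locale \<^locale>\<open>pair_bidirected_digraph\<close>; finiteness is not required): the edge
  \<open>{a, b}\<close> is the pair of arcs \<open>(a, b)\<close>, \<open>(b, a)\<close>.
  \<^const>\<open>mk_symmetric\<close> gives the underlying undirected graph of a digraph.
\<close>

locale oriented_digraph = pair_loopfree_digraph D for D :: "'a pair_pre_digraph" +
  assumes no_opposite_arcs: "(u, v) \<in> parcs D \<Longrightarrow> (v, u) \<notin> parcs D"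

definition orientation_of :: "'a pair_pre_digraph \<Rightarrow> 'a pair_pre_digraph \<Rightarrow> bool" where
  "orientation_of G D \<longleftrightarrow>
     pverts D = pverts G \<and> parcs D \<subseteq> parcs G \<and>
     (\<forall>a b. (a, b) \<in> parcs G \<longrightarrow> ((a, b) \<in> parcs D) \<noteq> ((b, a) \<in> parcs D))"

lemma oriented_digraph_orientation_of:
  assumes "pair_bidirected_digraph G" and "orientation_of G D"
  shows "oriented_digraph D"
proof -
  interpret pair_bidirected_digraph G by (fact assms(1))
  show ?thesis
    using assms(2) wellformed' pair_no_loops
    unfolding orientation_of_def by unfold_locales fastforce+
qed

text \<open>The infimum of the empty set in \<^typ>\<open>enat\<close> is \<open>\<infinity>\<close>.\<close>

definition graph_dist :: "'a pair_pre_digraph \<Rightarrow> 'a \<Rightarrow> 'a \<Rightarrow> enat" where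
  "graph_dist G u v =
     (INF p \<in> {p. vpath p (with_proj G) \<and> hd p = u \<and> last p = v}. enat (vwalk_length p))"

definition digraph_dist :: "'a pair_pre_digraph \<Rightarrow> 'a \<Rightarrow> 'a \<Rightarrow> enat" where
  "digraph_dist D = graph_dist (mk_symmetric (with_proj D))"

definition set_diameter :: "'a pair_pre_digraph \<Rightarrow> 'a set \<Rightarrow> enat" where
  "set_diameter G A = (SUP (u, v) \<in> A \<times> A. graph_dist G u v)"

definition omega_path :: "'a pair_pre_digraph \<Rightarrow> (nat \<Rightarrow> 'a) \<Rightarrow> bool" where
  "omega_path G v \<longleftrightarrow> inj v \<and> (\<forall>n. (v n, v (n + 1)) \<in> parcs G)"

definition directed_in :: "'a pair_pre_digraph \<Rightarrow> (nat \<Rightarrow> 'a) \<Rightarrow> bool" where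
  "directed_in D v \<longleftrightarrow>
     (\<forall>n. (v n, v (n + 1)) \<in> parcs D) \<or> (\<forall>n. (v (n + 1), v n) \<in> parcs D)"

definition I_omega :: "nat pair_pre_digraph" where
  "I_omega = \<lparr> pverts = UNIV, parcs = {(i, i + 1) | i. True} \<rparr>"

definition I_minus_omega :: "nat pair_pre_digraph" where
  "I_minus_omega = \<lparr> pverts = UNIV, parcs = {(i + 1, i) | i. True} \<rparr>"

lemma oriented_digraph_I_omega: "oriented_digraph I_omega"
  by unfold_locales (auto simp: I_omega_def)

lemma oriented_digraph_I_minus_omega: "oriented_digraph I_minus_omega"
  by unfold_locales (auto simp: I_minus_omega_def)

text \<open>\<open>G \<Rightarrow> H\<close> for a graph \<open>G\<close> and a digraph \<open>H\<close>.\<close>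

definition arrows :: "'a pair_pre_digraph \<Rightarrow> 'b pair_pre_digraph \<Rightarrow> bool" where
  "arrows G H \<longleftrightarrow>
     (\<forall>D. orientation_of G D \<longrightarrow>
       (\<exists>f. f \<in> pverts H \<rightarrow> pverts G \<and> inj_on f (pverts H) \<and>
         (\<forall>u\<in>pverts H. \<forall>v\<in>pverts H. (u, v) \<in> parcs H \<longleftrightarrow> (f u, f v) \<in> parcs D) \<and>
         (\<forall>u\<in>pverts H. \<forall>v\<in>pverts H. digraph_dist H u v = graph_dist G (f u) (f v))))"

end

theory Submission
  imports Defs
begin

text \<open>
  Let \<open>\<ell> v\<close> be the distance from \<open>v\<close> to a fixed root of its component. Orient every edge
  between two consecutive layers from the even layer to the odd one, and the edges within a layer
  arbitrarily. Along a directed path the parity of \<open>\<ell>\<close> changes at most once, and \<open>\<ell>\<close> is constant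
  while its parity is; so \<open>\<ell>\<close> is bounded on the path, which therefore has finite diameter.
  An induced isometric copy of \<open>I_omega\<close> or \<open>I_minus_omega\<close> would be a directed path of infinite
  diameter.
\<close>

text \<open>\<open>l\<close> is the distance to a root of the component. A shortest walk to one end
  of an edge extends along the edge, which gives the first property. The walk from \<open>u\<close>
  back to the root and on to \<open>v\<close> gives the second, with exactly
  \<open>l u + l v\<close> steps.\<close>

lemma sym_imp_layering:
  assumes "sym R"
  obtains l :: "'a \<Rightarrow> nat"
  where "\<And>u v. (u, v) \<in> R \<Longrightarrow> l v \<le> Suc (l u)"
    and "\<And>u v. (u, v) \<in> R\<^sup>* \<Longrightarrow> (u, v) \<in> R ^^ (l u + l v)"
proof -
  \<comment> \<open>As \<open>R\<close> is symmetric, the predicate under \<open>SOME\<close>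
    depends only on the component of \<open>v\<close>, so all its vertices get the same
    root.\<close>
  define root where "root v = (SOME w. (w, v) \<in> R\<^sup>*)" for v
  define l where "l v = (LEAST n. (root v, v) \<in> R ^^ n)" for v
  have root: "(root v, v) \<in> R\<^sup>*" for v
    unfolding root_def by (rule someI[of _ v]) simp
  have root_eq: "root u = root v" if "(u, v) \<in> R\<^sup>*" for u v
  proof -
    have "(v, u) \<in> R\<^sup>*"
      using that sym_rtrancl[OF assms] by (blast dest: symD)
    with that have "(w, u) \<in> R\<^sup>* \<longleftrightarrow> (w, v) \<in> R\<^sup>*" for w
      by (meson rtrancl_trans)
    then show ?thesis
      by (simp add: root_def)
  qed
  have l: "(root v, v) \<in> R ^^ l v" for v
    unfolding l_def using rtrancl_imp_relpow[OF root] by (rule LeastI_ex)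
  have relpow_sym: "(y, x) \<in> R ^^ n" if "(x, y) \<in> R ^^ n" for x y n
    using that
  proof (induction n arbitrary: y)
    case (Suc n)
    then show ?case
      using assms by (meson relpow_Suc_E relpow_Suc_I2 symD)
  qed simp
  show ?thesis
  proof
    fix u v assume uv: "(u, v) \<in> R"
    then have "(root v, v) \<in> R ^^ Suc (l u)"
      using l[of u] root_eq[OF r_into_rtrancl[OF uv]] by auto
    then show "l v \<le> Suc (l u)"
      unfolding l_def[of v] by (rule Least_le)
  next
    fix u v assume "(u, v) \<in> R\<^sup>*"
    then have "(root u, v) \<in> R ^^ l v"
      using l[of v] root_eq by simp
    then show "(u, v) \<in> R ^^ (l u + l v)"
      unfolding relpow_add using relpow_sym[OF l[of u]] by blast
  qed
qed

text \<open>One parity is absorbing, so the parity of \<open>f n\<close> is eventually constant.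
  From then on a step of size at most one that keeps the parity must be zero.\<close>

lemma bounded_if_parity_settles:
  fixes f :: "nat \<Rightarrow> nat"
  assumes step: "\<And>n. f (Suc n) \<le> Suc (f n)" "\<And>n. f n \<le> Suc (f (Suc n))"
    and parity: "(\<forall>n. even (f n) \<longrightarrow> even (f (Suc n))) \<or> (\<forall>n. odd (f n) \<longrightarrow> odd (f (Suc n)))"
  obtains B where "\<And>n. f n \<le> B"
proof -
  have "\<exists>N. \<forall>n\<ge>N. even (f n) = even (f N)"
  proof -
    have stable: "\<forall>n\<ge>N. P (f n)" if "P (f N)" "\<forall>n. P (f n) \<longrightarrow> P (f (Suc n))"
      for P :: "nat \<Rightarrow> bool" and N
    proof (intro allI impI)
      fix n assume "N \<le> n"
      then show "P (f n)"
        by (induction rule: dec_induct) (use that in auto)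
    qed
    \<comment> \<open>If the absorbing parity is ever attained, \<open>N\<close> is such a time;
      otherwise the other parity persists from 0 on.\<close>
    show ?thesis
      using parity stable[of even] stable[of odd] by metis
  qed
  then obtain N where N: "\<And>n. n \<ge> N \<Longrightarrow> even (f n) = even (f N)"
    by blast
  have const: "f n = f N" if "N \<le> n" for n
    using that
  proof (induction rule: dec_induct)
    case (step n)
    have "even (f (Suc n)) = even (f n)"
      using N step.hyps by (metis le_Suc_eq)
    moreover have "f (Suc n) \<noteq> Suc (f n)" "f n \<noteq> Suc (f (Suc n))"
      using calculation by (metis even_Suc)+
    ultimately show ?case
      using assms(1,2)[of n] step.IH by linarith
  qed simp
  show ?thesis
  proof
    fix n
    show "f n \<le> Max (f ` {..N})"
      using const[of n] by (cases "n \<le> N") auto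
  qed
qed

lemma (in pair_wf_digraph) relpow_imp_vwalk:
  assumes "(u, v) \<in> parcs G ^^ n" "u \<in> pverts G"
  shows "\<exists>p. vwalk p (with_proj G) \<and> hd p = u \<and> last p = v \<and> length p = Suc n"
  using assms
proof (induction n arbitrary: u)
  case 0
  then show ?case
    by (intro exI[of _ "[u]"]) (auto simp: vwalk_def)
next
  case (Suc n)
  from Suc.prems(1) obtain w where w: "(u, w) \<in> parcs G" "(w, v) \<in> parcs G ^^ n"
    by (blast dest: relpow_Suc_D2)
  then obtain p where "vwalk p (with_proj G)" "hd p = w" "last p = v" "length p = Suc n"
    using Suc.IH in_arcsD2 by blast
  then show ?case
    using w Suc.prems(2) by (intro exI[of _ "u # p"]) (auto intro: vwalk_consI)
qed

lemma length_vwalk_to_vpath_le: "length (vwalk_to_vpath p) \<le> length p"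
proof (induction p rule: vwalk_to_vpath_induct3)
  case (in_set x xs)
  then show ?case
    using length_dropWhile_le[of "\<lambda>y. y \<noteq> x" xs] by auto
qed auto

text \<open>\<open>graph_dist\<close> ranges over paths without repeated vertices, so the walk is
  first cut down to a path, which does not lengthen it.\<close>

lemma (in pair_wf_digraph) graph_dist_le_relpow:
  assumes "(u, v) \<in> parcs G ^^ n" "u \<in> pverts G"
  shows "graph_dist G u v \<le> enat n"
proof -
  obtain p where p: "vwalk p (with_proj G)" "hd p = u" "last p = v" "length p = Suc n"
    using relpow_imp_vwalk[OF assms] by blast
  have "graph_dist G u v \<le> enat (vwalk_length (vwalk_to_vpath p))"
    unfolding graph_dist_def using p
    by (intro INF_lower) (simp add: vwalk_to_vpath_vpath vwalk_to_vpath_hd vwalk_to_vpath_last)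
  also have "\<dots> \<le> enat n"
    using length_vwalk_to_vpath_le[of p] p by simp
  finally show ?thesis .
qed

lemma omega_path_rtrancl:
  assumes "omega_path G v" "sym (parcs G)"
  shows "(v i, v j) \<in> (parcs G)\<^sup>*"
proof -
  have "(v 0, v n) \<in> (parcs G)\<^sup>*" for n
    using assms(1) by (induction n) (auto simp: omega_path_def intro: rtrancl.rtrancl_into_rtrancl)
  then show ?thesis
    using sym_rtrancl[OF assms(2)] by (meson rtrancl_trans symD)
qed

lemma orientation_no_directed_unbounded_path:
  assumes "pair_bidirected_digraph G"
  obtains D where "orientation_of G D"
    and "\<And>v. omega_path G v \<Longrightarrow> directed_in D v \<Longrightarrow> set_diameter G (range v) \<noteq> \<infinity>"
proof -
  interpret pair_bidirected_digraph G by (fact assms)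
  have sym: "sym (parcs G)"
    using pair_sym_arcs by (simp add: symmetric_def)
  obtain l :: "'a \<Rightarrow> nat" where step: "\<And>u v. (u, v) \<in> parcs G \<Longrightarrow> l v \<le> Suc (l u)"
    and dist: "\<And>u v. (u, v) \<in> (parcs G)\<^sup>* \<Longrightarrow> (u, v) \<in> parcs G ^^ (l u + l v)"
    using sym_imp_layering[OF sym] by blast
  \<comment> \<open>The argument is the unordered pair, so \<open>a = pick {a, b}\<close> selects
    exactly one of the two arcs of an edge within a layer.\<close>
  define pick :: "'a set \<Rightarrow> 'a" where "pick A = (SOME x. x \<in> A)" for A
  define D where "D = \<lparr> pverts = pverts G, parcs = {(a, b) \<in> parcs G.
      even (l a) \<and> odd (l b) \<or> even (l a) = even (l b) \<and> a = pick {a, b}} \<rparr>"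
  have "orientation_of G D"
    unfolding orientation_of_def
  proof (intro conjI allI impI)
    fix a b assume ab: "(a, b) \<in> parcs G"
    then have "(b, a) \<in> parcs G" "a \<noteq> b"
      using sym pair_no_loops[OF ab] by (auto dest: symD)
    moreover have "pick {a, b} \<in> {a, b}"
      unfolding pick_def by (rule someI[of _ a]) simp
    then have "pick {a, b} = a \<or> pick {a, b} = b"
      by simp
    ultimately show "((a, b) \<in> parcs D) \<noteq> ((b, a) \<in> parcs D)"
      using ab by (auto simp: D_def insert_commute[of b a])
  qed (auto simp: D_def)
  moreover have "set_diameter G (range v) \<noteq> \<infinity>"
    if path: "omega_path G v" and dir: "directed_in D v" for v
  proof -
    have arc: "(v n, v (Suc n)) \<in> parcs G" for n
      using path by (simp add: omega_path_def)
    \<comment> \<open>No arc of \<open>D\<close> leads from an odd layer to an even one: a forward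
      path cannot leave the odd layers, a backward path cannot leave the even ones.\<close>
    have parity: "(\<forall>n. even (l (v n)) \<longrightarrow> even (l (v (Suc n)))) \<or>
        (\<forall>n. odd (l (v n)) \<longrightarrow> odd (l (v (Suc n))))"
      using dir by (auto simp: directed_in_def D_def)
    obtain B where B: "\<And>n. l (v n) \<le> B"
      by (rule bounded_if_parity_settles[of "\<lambda>n. l (v n)",
            OF step[OF arc] step[OF symD[OF sym arc]] parity]) (rule that)
    have "graph_dist G (v i) (v j) \<le> enat (2 * B)" for i j
    proof -
      have "graph_dist G (v i) (v j) \<le> enat (l (v i) + l (v j))"
        using dist[OF omega_path_rtrancl[OF path sym]] in_arcsD1[OF arc]
        by (rule graph_dist_le_relpow)
      also have "\<dots> \<le> enat (2 * B)"
        using B[of i] B[of j] by simp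
      finally show ?thesis .
    qed
    then have "set_diameter G (range v) \<le> enat (2 * B)"
      unfolding set_diameter_def by (intro SUP_least) auto
    then show ?thesis
      by (cases "set_diameter G (range v)") simp_all
  qed
  ultimately show ?thesis
    by (rule that)
qed

text \<open>Each edge, in either direction, changes \<open>g\<close> by at most one, so every path
  needs at least this many edges. Truncated subtraction only weakens the bound to 0.\<close>

lemma le_digraph_dist_if_lipschitz:
  fixes g :: "'b \<Rightarrow> nat"
  assumes "\<And>a b. (a, b) \<in> parcs H \<Longrightarrow> g b \<le> Suc (g a) \<and> g a \<le> Suc (g b)"
  shows "enat (g v - g u) \<le> digraph_dist H u v"
  unfolding digraph_dist_def graph_dist_def
proof (intro INF_greatest, clarify)
  fix p assume "vpath p (with_proj (mk_symmetric (with_proj H)))"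
  then have "vwalk p (with_proj (mk_symmetric (with_proj H)))"
    by blast
  then have "g (last p) - g (hd p) \<le> length p - 1"
  proof (induction p)
    case (Cons a b es)
    then have "g b \<le> Suc (g a)"
      using assms by (auto simp: parcs_mk_symmetric)
    with Cons show ?case
      by auto
  qed simp
  then show "enat (g (last p) - g (hd p)) \<le> enat (vwalk_length p)"
    by simp
qed

text \<open>The embedding is itself the path: it preserves the distance from 0 to \<open>n\<close>,
  which is at least \<open>n\<close>. Both rays are covered at once, since
  \<open>directed_in\<close> allows either direction.\<close>

lemma arrows_ray_imp_unbounded_path:
  fixes H :: "nat pair_pre_digraph"
  assumes "arrows G H" "orientation_of G D" "sym (parcs G)"
    and verts: "pverts H = UNIV"
    and arcs: "parcs H = {(i, i + 1) | i. True} \<or> parcs H = {(i + 1, i) | i. True}"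
  shows "\<exists>v. omega_path G v \<and> directed_in D v \<and> set_diameter G (range v) = \<infinity>"
proof -
  from assms(1,2) verts obtain f where inj: "inj f"
    and iff: "\<And>u v. (u, v) \<in> parcs H \<longleftrightarrow> (f u, f v) \<in> parcs D"
    and dist: "\<And>u v. digraph_dist H u v = graph_dist G (f u) (f v)"
    unfolding arrows_def by auto
  have diam: "enat n \<le> set_diameter G (range f)" for n
  proof -
    have "enat (n - 0) \<le> digraph_dist H 0 n"
      using arcs by (intro le_digraph_dist_if_lipschitz[where g = "\<lambda>i. i"]) auto
    also have "\<dots> \<le> set_diameter G (range f)"
      unfolding dist set_diameter_def by (rule SUP_upper2[of "(f 0, f n)"]) auto
    finally show ?thesis
      by simp
  qed
  have dir: "directed_in D f"
    using arcs iff by (auto simp: directed_in_def)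
  \<comment> \<open>For a backward path, symmetry of \<open>G\<close> supplies the forward
    arcs.\<close>
  moreover have "omega_path G f"
    using dir assms(2,3) inj
    unfolding omega_path_def directed_in_def orientation_of_def by (blast dest: symD)
  moreover have "set_diameter G (range f) = \<infinity>"
  proof (cases "set_diameter G (range f)")
    case (enat m)
    then show ?thesis
      using diam[of "Suc m"] by simp
  qed simp
  ultimately show ?thesis
    by blast
qed

theorem theorem6p2:
  fixes G :: "'a pair_pre_digraph"
  assumes "pair_bidirected_digraph G"
  shows "(\<exists>D. orientation_of G D \<and>
            \<not> (\<exists>v. omega_path G v \<and> directed_in D v \<and> set_diameter G (range v) = \<infinity>))
         \<and> \<not> arrows G I_omega
         \<and> \<not> arrows G I_minus_omega"
proof -
  interpret pair_bidirected_digraph G by (fact assms)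
  have sym: "sym (parcs G)"
    using pair_sym_arcs by (simp add: symmetric_def)
  obtain D where D: "orientation_of G D"
    "\<not> (\<exists>v. omega_path G v \<and> directed_in D v \<and> set_diameter G (range v) = \<infinity>)"
    using orientation_no_directed_unbounded_path[OF assms] by metis
  have "\<not> arrows G I_omega" "\<not> arrows G I_minus_omega"
    using arrows_ray_imp_unbounded_path[OF _ D(1) sym, of I_omega]
      arrows_ray_imp_unbounded_path[OF _ D(1) sym, of I_minus_omega] D(2)
    by (auto simp: I_omega_def I_minus_omega_def)
  with D show ?thesis
    by blast
qed

end
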